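(* Let $\mathcal{F}_{\mathrm{st}}$ be the filter of statistical convergence. Then for every Banach space $X$ over $\mathbb{K}$ and every $\mathcal{F}_{\mathrm{st}}$-basis $(e_n)_{n=1}^\infty$ of $X$, the corresponding coordinate functionals $e_n^*\colon X\to\mathbb{K}$ ($n\in\mathbb{N}$) are continuous.
   Context: $\mathbb{K}$ is the fixed scalar field, either $\mathbb{R}$ or $\mathbb{C}$; $\mathbb{N}=\{1,2,\dots\}$. The filter of statistical convergence $\mathcal{F}_{\mathrm{st}}$ is the family of all subsets $A\subset\mathbb{N}$ having (asymptotic) density $1$, i.e. $\lim_{n\to\infty}|A\cap\{1,\dots,n\}|/n=1$. For a filter $\mathcal{F}$ on $\mathbb{N}$, a sequence $(x_n)_{n=1}^\infty$ in a normed space $\mathcal{F}$-converges to $x$ if for every $\varepsilon>0$ there is $A\in\mathcal{F}$ such that $\|x-x_n\|<\varepsilon$ for all $n\in A$. A sequence $(e_n)_{n=1}^\infty$ in a Banach space $X$ is an $\mathcal{F}$-basis of $X$ if for each $x\in X$ there is a unique sequence of scalars $(e_n^*(x))_{n=1}^\infty$ such that $x=\sum_{n,\mathcal{F}}e_n^*(x)e_n$, meaning that the partial sums $\sum_{i=1}^n e_i^*(x)e_i$ $\mathcal{F}$-converge to $x$. The linear maps $x\mapsto e_n^*(x)$ are the coordinate functionals of the basis. *)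

theory Defs
  imports "HOL-Analysis.Analysis"
begin

text \<open>
  Filters are library filters on \<^typ>\<open>nat\<close>: a set \<open>A\<close> belongs to \<open>F\<close> iff
  \<open>\<forall>\<^sub>F n in F. n \<in> A\<close>, and \<open>F\<close>-convergence of \<open>x\<close> to \<open>l\<close> is \<open>(x \<longlongrightarrow> l) F\<close>.
\<close>

definition has_density_one :: "nat set \<Rightarrow> bool" where
  "has_density_one A \<longleftrightarrow> (\<lambda>n. real (card (A \<inter> {1..n})) / real n) \<longlonglongrightarrow> 1"

text \<open>The number 0 plays no role here, so this is the filter on the positive integers.\<close>

definition statistical :: "nat filter" where
  "statistical = Abs_filter (\<lambda>P. has_density_one {n. P n})"

lemma has_density_one_mono:
  assumes A: "has_density_one A" and "A \<subseteq> B"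
  shows "has_density_one B"
  unfolding has_density_one_def
proof (rule tendsto_sandwich[OF _ _ A[unfolded has_density_one_def] tendsto_const])
  have "card (A \<inter> {1..n}) \<le> card (B \<inter> {1..n})" for n
    by (rule card_mono) (use \<open>A \<subseteq> B\<close> in auto)
  then show "\<forall>\<^sub>F n in sequentially.
      real (card (A \<inter> {1..n})) / real n \<le> real (card (B \<inter> {1..n})) / real n"
    by (intro always_eventually allI divide_right_mono) auto
  have "card (B \<inter> {1..n}) \<le> n" for n
    using card_mono[of "{1..n}" "B \<inter> {1..n}"] by auto
  then show "\<forall>\<^sub>F n in sequentially. real (card (B \<inter> {1..n})) / real n \<le> 1"
    by (intro eventually_mono[OF eventually_gt_at_top[of 0]]) (simp add: divide_le_eq_1)
qed

lemma has_density_one_Int: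
  assumes A: "has_density_one A" and B: "has_density_one B"
  shows "has_density_one (A \<inter> B)"
  unfolding has_density_one_def
proof (rule tendsto_sandwich[OF _ _ _ tendsto_const])
  have le: "card (A \<inter> {1..n}) + card (B \<inter> {1..n}) \<le> n + card (A \<inter> B \<inter> {1..n})" for n
  proof -
    have "card (A \<inter> {1..n}) + card (B \<inter> {1..n}) =
        card ((A \<inter> {1..n}) \<union> (B \<inter> {1..n})) + card ((A \<inter> {1..n}) \<inter> (B \<inter> {1..n}))"
      by (rule card_Un_Int) auto
    moreover have "card ((A \<inter> {1..n}) \<union> (B \<inter> {1..n})) \<le> card {1..n}"
      by (rule card_mono) auto
    moreover have "(A \<inter> {1..n}) \<inter> (B \<inter> {1..n}) = A \<inter> B \<inter> {1..n}"
      by auto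
    ultimately show ?thesis by simp
  qed
  have "real (card (A \<inter> {1..n})) / real n + real (card (B \<inter> {1..n})) / real n - 1
      \<le> real (card (A \<inter> B \<inter> {1..n})) / real n" if "n > 0" for n
  proof -
    have "real (card (A \<inter> {1..n})) + real (card (B \<inter> {1..n}))
        \<le> real n + real (card (A \<inter> B \<inter> {1..n}))"
      using le[of n] by linarith
    then have "(real (card (A \<inter> {1..n})) + real (card (B \<inter> {1..n}))) / real n
        \<le> (real n + real (card (A \<inter> B \<inter> {1..n}))) / real n"
      by (rule divide_right_mono) simp
    then show ?thesis
      using that by (simp add: add_divide_distrib)
  qed
  then show "\<forall>\<^sub>F n in sequentially.
      real (card (A \<inter> {1..n})) / real n + real (card (B \<inter> {1..n})) / real n - 1
      \<le> real (card (A \<inter> B \<inter> {1..n})) / real n"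
    by (intro eventually_mono[OF eventually_gt_at_top[of 0]])
  show "(\<lambda>n. real (card (A \<inter> {1..n})) / real n + real (card (B \<inter> {1..n})) / real n - 1)
      \<longlonglongrightarrow> 1"
    using tendsto_diff[OF tendsto_add[OF A[unfolded has_density_one_def]
        B[unfolded has_density_one_def]] tendsto_const[of 1]] by simp
  have "card (A \<inter> B \<inter> {1..n}) \<le> n" for n
    using card_mono[of "{1..n}" "A \<inter> B \<inter> {1..n}"] by auto
  then show "\<forall>\<^sub>F n in sequentially. real (card (A \<inter> B \<inter> {1..n})) / real n \<le> 1"
    by (intro eventually_mono[OF eventually_gt_at_top[of 0]]) (simp add: divide_le_eq_1)
qed

lemma has_density_one_UNIV: "has_density_one UNIV"
proof -
  have "\<forall>\<^sub>F n in sequentially. 1 = real (card (UNIV \<inter> {1..n})) / real n"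
    by (intro eventually_mono[OF eventually_gt_at_top[of 0]]) simp
  then show ?thesis
    unfolding has_density_one_def by (rule Lim_transform_eventually[OF tendsto_const])
qed

lemma eventually_statistical:
  "eventually P statistical \<longleftrightarrow> has_density_one {n. P n}"
  unfolding statistical_def
proof (rule eventually_Abs_filter, rule is_filter.intro)
  show "has_density_one {n. True}"
    using has_density_one_UNIV by simp
  show "has_density_one {n. P n \<and> Q n}"
    if "has_density_one {n. P n}" "has_density_one {n. Q n}" for P Q :: "nat \<Rightarrow> bool"
    using has_density_one_Int[OF that] by (simp add: Collect_conj_eq)
  show "has_density_one {n. Q n}"
    if "\<forall>n. P n \<longrightarrow> Q n" "has_density_one {n. P n}" for P Q :: "nat \<Rightarrow> bool"
    by (rule has_density_one_mono[OF that(2)]) (use that(1) in auto)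
qed

text \<open>
  The library has no complex normed spaces. A normed space over the reals or the complex numbers
  is rendered as a real normed space together with a scalar multiplication by \<open>'k\<close> that extends
  the real one and for which the norm is homogeneous. Completeness only concerns the norm, so a
  Banach space is obtained by taking the carrier type in class \<^class>\<open>banach\<close>.
\<close>

locale normed_space_over = vector_space smul
  for smul :: "'k::real_normed_field \<Rightarrow> 'a::real_normed_vector \<Rightarrow> 'a" +
  assumes smul_of_real: "smul (of_real r) x = r *\<^sub>R x"
    and norm_smul: "norm (smul c x) = norm c * norm x"

text \<open>
  As in \<^const>\<open>sums\<close>, the terms of a series are indexed from 0: \<open>f i\<close> is the term of
  number \<open>i + 1\<close>, and the partial sum at position \<open>n\<close> of the filter consists of the first \<open>n\<close> terms.
\<close>

definition filter_sums :: "nat filter \<Rightarrow> (nat \<Rightarrow> 'a::real_normed_vector) \<Rightarrow> 'a \<Rightarrow> bool" where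
  "filter_sums F f s \<longleftrightarrow> ((\<lambda>n. \<Sum>i<n. f i) \<longlongrightarrow> s) F"

definition filter_basis ::
    "nat filter \<Rightarrow> ('k \<Rightarrow> 'a \<Rightarrow> 'a) \<Rightarrow> (nat \<Rightarrow> 'a::real_normed_vector) \<Rightarrow> bool" where
  "filter_basis F smul e \<longleftrightarrow> (\<forall>x. \<exists>!c. filter_sums F (\<lambda>i. smul (c i) (e i)) x)"

definition coordinate ::
    "nat filter \<Rightarrow> ('k \<Rightarrow> 'a \<Rightarrow> 'a) \<Rightarrow> (nat \<Rightarrow> 'a::real_normed_vector) \<Rightarrow> nat \<Rightarrow> 'a \<Rightarrow> 'k" where
  "coordinate F smul e n x = (THE c. filter_sums F (\<lambda>i. smul (c i) (e i)) x) n"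

lemma real_normed_space_over: "normed_space_over (scaleR :: real \<Rightarrow> 'a::real_normed_vector \<Rightarrow> 'a)"
  by unfold_locales (simp_all add: scaleR_add_right scaleR_add_left)

end

theory Submission
  imports Defs
begin

text \<open>
  The continuity of coordinate functionals for ordinary Schauder bases comes from the open mapping
  theorem: the coefficient sequences of convergent series form a complete space under the
  supremum of the norms of the partial sums, and the map sending coefficients to the sum is a
  continuous bijection. For statistical convergence the partial sums may be unbounded, but the
  same idea works with another complete metric. A sequence \<open>s\<close> converges statistically to \<open>l\<close>
  iff the averages over \<open>m \<le> n\<close> of \<open>min 1 (norm (s m - l))\<close> tend to 0 as \<open>n\<close> grows
  (\<open>tendsto_statistical_iff\<close>). The supremum over \<open>n\<close> of such averages, with \<open>l = 0\<close>, is
  subadditive although not homogeneous; it controls every single term of the sequence as well as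
  its statistical limit, and on statistically convergent sequences it is a complete F-norm. So the
  partial-sum sequences of basis expansions form an F-space that maps continuously and
  bijectively onto the Banach space.

  The open mapping theorem enters in the form of Zabreiko's lemma, for gauges that are not
  homogeneous (\<open>countably_subadditive_gauge_continuous_at_0\<close>): by the Baire category theorem an
  even, countably subadditive gauge \<open>p\<close> on a Banach space is continuous at 0 as soon as
  \<open>p (x / k)\<close> tends to 0 for each \<open>x\<close>. It is applied to the gauge of the sequence of partial sums
  of the expansion of \<open>x\<close>. Countable subadditivity is the completeness statement
  (\<open>statistical_limit_suminf\<close>): a series of statistically convergent sequences whose gauges are
  summable converges statistically to the sum of the limits, and the uniqueness of
  expansions identifies the result. Once the gauge is small near 0, so is
  each partial sum, and hence each coordinate, which is a difference of two partial sums divided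
  by a nonzero basis vector.
\<close>

section \<open>Countably subadditive gauges\<close>

lemma gauge_finite_subadditive:
  fixes p :: "'a::banach \<Rightarrow> real"
  assumes shrink: "\<And>x. (\<lambda>k. p (x /\<^sub>R real (Suc k))) \<longlonglongrightarrow> 0"
    and subadd: "\<And>f x. f sums x \<Longrightarrow> summable (\<lambda>j. p (f j)) \<Longrightarrow> p x \<le> (\<Sum>j. p (f j))"
  shows "p (x + y) \<le> p x + p y"
proof -
  have "(\<lambda>k::nat. p 0) \<longlonglongrightarrow> 0"
    using shrink[of 0] by simp
  then have p0: "p 0 = 0"
    by (simp add: LIMSEQ_const_iff)
  define f where "f = (\<lambda>j::nat. if j = 0 then x else if j = 1 then y else 0)"
  have fsums: "f sums (\<Sum>j\<in>{0,1}. f j)"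
    by (rule sums_finite) (auto simp: f_def)
  have psums: "(\<lambda>j. p (f j)) sums (\<Sum>j\<in>{0,1}. p (f j))"
    by (rule sums_finite) (auto simp: f_def p0)
  show ?thesis
    using subadd[OF fsums sums_summable[OF psums]] sums_unique[OF psums]
    by (simp add: f_def)
qed

text \<open>
  The Baire step. Since \<open>p (x / k)\<close> tends to 0, the integer multiples of the sublevel set for
  \<open>\<epsilon> / 2\<close> cover the space, so one of them, hence the sublevel set itself, is dense in some ball.
  Differences of two of its points are dense in a ball around 0, and as \<open>p\<close> is even and
  subadditive they lie in the sublevel set for \<open>\<epsilon>\<close>.
\<close>

lemma gauge_sublevel_dense_near_0:
  fixes p :: "'a::banach \<Rightarrow> real"
  assumes even: "\<And>x. p (- x) = p x"
    and shrink: "\<And>x. (\<lambda>k. p (x /\<^sub>R real (Suc k))) \<longlonglongrightarrow> 0"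
    and add: "\<And>x y. p (x + y) \<le> p x + p y"
    and "\<epsilon> > 0"
  shows "\<exists>\<delta>>0. ball 0 \<delta> \<subseteq> closure {x. p x \<le> \<epsilon>}"
proof -
  define B where "B = {x. p x \<le> \<epsilon> / 2}"
  define C where "C k = closure ((\<lambda>x. real (Suc k) *\<^sub>R x) ` B)" for k
  have cover: "(\<Union>k. C k) = UNIV"
  proof (intro UNIV_eq_I[symmetric])
    fix x
    have "\<forall>\<^sub>F k in sequentially. p (x /\<^sub>R real (Suc k)) < \<epsilon> / 2"
      by (rule order_tendstoD(2)[OF shrink]) (use \<open>\<epsilon> > 0\<close> in simp)
    then obtain k where "p (x /\<^sub>R real (Suc k)) < \<epsilon> / 2"
      using eventually_happens'[OF sequentially_bot] by blast
    then have "real (Suc k) *\<^sub>R (x /\<^sub>R real (Suc k)) \<in> C k"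
      unfolding C_def B_def by (intro subsetD[OF closure_subset] imageI) simp
    then show "x \<in> (\<Union>k. C k)"
      by (auto simp del: of_nat_Suc)
  qed
  have "\<exists>k. interior (C k) \<noteq> {}"
  proof (rule ccontr)
    assume "\<nexists>k. interior (C k) \<noteq> {}"
    then have "euclidean interior_of \<Union>(range C) = {}"
      by (intro Baire_category_alt) (auto simp: completely_metrizable_space_euclidean C_def)
    then show False
      using cover by simp
  qed
  then obtain k y where "y \<in> interior (C k)"
    by blast
  then obtain r where r: "r > 0" "ball y r \<subseteq> C k"
    by (meson mem_interior)
  have dense: "\<exists>u\<in>B. norm (u - w /\<^sub>R real (Suc k)) < \<eta>" if "w \<in> ball y r" "\<eta> > 0" for w \<eta>
  proof -
    have "w \<in> C k" "\<eta> * real (Suc k) > 0"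
      using r that by auto
    then obtain u where u: "u \<in> B" "norm (real (Suc k) *\<^sub>R u - w) < \<eta> * real (Suc k)"
      unfolding C_def closure_approachable dist_norm by blast
    have "real (Suc k) *\<^sub>R u - w = real (Suc k) *\<^sub>R (u - w /\<^sub>R real (Suc k))"
      by (simp add: scaleR_diff_right del: of_nat_Suc)
    then have "norm (u - w /\<^sub>R real (Suc k)) < \<eta>"
      using u(2) by (simp add: mult.commute del: of_nat_Suc)
    then show ?thesis
      using u by blast
  qed
  have "z \<in> closure {x. p x \<le> \<epsilon>}" if z: "norm z < r / real (Suc k)" for z
    unfolding closure_approachable dist_norm
  proof (intro allI impI)
    fix \<eta> :: real
    assume "\<eta> > 0"
    have "y + real (Suc k) *\<^sub>R z \<in> ball y r"
      using z by (simp add: dist_norm pos_less_divide_eq mult.commute del: of_nat_Suc)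
    from dense[OF this, of "\<eta> / 2"] \<open>\<eta> > 0\<close> obtain u
      where u: "u \<in> B" "norm (u - (y + real (Suc k) *\<^sub>R z) /\<^sub>R real (Suc k)) < \<eta> / 2"
      by auto
    obtain v where v: "v \<in> B" "norm (v - y /\<^sub>R real (Suc k)) < \<eta> / 2"
      using dense[of y "\<eta> / 2"] \<open>\<eta> > 0\<close> r by auto
    have "p (u - v) \<le> \<epsilon>"
      using add[of u "- v"] u(1) v(1) even[of v] by (simp add: B_def)
    moreover have "(u - v) - z = (u - (y + real (Suc k) *\<^sub>R z) /\<^sub>R real (Suc k))
        - (v - y /\<^sub>R real (Suc k))"
      by (simp add: scaleR_add_right del: of_nat_Suc)
    then have "norm ((u - v) - z) \<le> norm (u - (y + real (Suc k) *\<^sub>R z) /\<^sub>R real (Suc k))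
        + norm (v - y /\<^sub>R real (Suc k))"
      by (simp only: norm_triangle_ineq4)
    then have "norm ((u - v) - z) < \<eta>"
      using u(2) v(2) by linarith
    ultimately show "\<exists>y\<in>{x. p x \<le> \<epsilon>}. norm (y - z) < \<eta>"
      by blast
  qed
  then show ?thesis
    using r(1) by (intro exI[of _ "r / real (Suc k)"]) auto
qed

text \<open>
  Zabreiko's lemma. A small \<open>x\<close> is written as a series by successive approximation: each residual
  lies in a ball where a sublevel set is dense, so it can be approximated by a term of small gauge,
  leaving a residual small enough for the next, smaller sublevel set. Countable subadditivity
  then bounds \<open>p x\<close> by a geometric series. It plays the role of both the completeness of the
  domain and the closed graph in the usual argument.
\<close>

lemma countably_subadditive_gauge_continuous_at_0:
  fixes p :: "'a::banach \<Rightarrow> real"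
  assumes nonneg: "\<And>x. p x \<ge> 0"
    and even: "\<And>x. p (- x) = p x"
    and shrink: "\<And>x. (\<lambda>k. p (x /\<^sub>R real (Suc k))) \<longlonglongrightarrow> 0"
    and subadd: "\<And>f x. f sums x \<Longrightarrow> summable (\<lambda>j. p (f j)) \<Longrightarrow> p x \<le> (\<Sum>j. p (f j))"
    and "\<epsilon> > 0"
  shows "\<exists>\<delta>>0. \<forall>x. norm x < \<delta> \<longrightarrow> p x \<le> \<epsilon>"
proof -
  have add: "p (x + y) \<le> p x + p y" for x y
    using shrink subadd by (rule gauge_finite_subadditive)
  have "\<forall>j. \<exists>\<delta>>0. ball 0 \<delta> \<subseteq> closure {x. p x \<le> \<epsilon> * (1/2) ^ Suc j}"
    using \<open>\<epsilon> > 0\<close> by (intro allI gauge_sublevel_dense_near_0[of p] even shrink add) simp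
  then obtain \<delta> where \<delta>: "\<And>j. \<delta> j > 0" "\<And>j. ball 0 (\<delta> j) \<subseteq> closure {x. p x \<le> \<epsilon> * (1/2) ^ Suc j}"
    by metis
  \<comment> \<open>The second argument of \<open>min\<close> makes the residuals tend to 0.\<close>
  define \<eta> where "\<eta> j = min (\<delta> j) ((1/2) ^ j)" for j
  have \<eta>_pos: "\<eta> j > 0" for j
    using \<delta> by (simp add: \<eta>_def)
  have step_ex: "\<exists>y. p y \<le> \<epsilon> * (1/2) ^ Suc j \<and> norm (r - y) < \<eta> (Suc j)"
    if "norm r < \<eta> j" for r j
  proof -
    have "r \<in> closure {x. p x \<le> \<epsilon> * (1/2) ^ Suc j}"
      using \<delta>(2)[of j] that by (auto simp: \<eta>_def)
    then show ?thesis
      using \<eta>_pos[of "Suc j"] unfolding closure_approachable dist_norm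
      by (metis mem_Collect_eq norm_minus_commute)
  qed
  define step where
    "step j r = (SOME y. p y \<le> \<epsilon> * (1/2) ^ Suc j \<and> norm (r - y) < \<eta> (Suc j))" for j r
  have step: "p (step j r) \<le> \<epsilon> * (1/2) ^ Suc j" "norm (r - step j r) < \<eta> (Suc j)"
    if "norm r < \<eta> j" for r j
    using someI_ex[OF step_ex[OF that]] unfolding step_def by blast+
  have "p x \<le> \<epsilon>" if x: "norm x < \<eta> 0" for x
  proof -
    define r where "r = rec_nat x (\<lambda>j r. r - step j r)"
    define y where "y j = step j (r j)" for j
    have r_0: "r 0 = x" and r_Suc: "r (Suc j) = r j - y j" for j
      by (simp_all add: r_def y_def)
    have r_small: "norm (r j) < \<eta> j" for j
      by (induction j) (simp_all add: r_0 r_Suc x step y_def)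
    have "r \<longlonglongrightarrow> 0"
    proof (rule Lim_null_comparison)
      show "\<forall>\<^sub>F j in sequentially. norm (r j) \<le> (1/2) ^ j"
        using r_small by (intro always_eventually allI) (auto simp: \<eta>_def intro: less_imp_le)
      show "(\<lambda>j. (1/2) ^ j :: real) \<longlonglongrightarrow> 0"
        by (rule LIMSEQ_power_zero) simp
    qed
    moreover have "(\<Sum>j<J. y j) = x - r J" for J
      by (induction J) (simp_all add: r_0 r_Suc)
    ultimately have y_sums: "y sums x"
      unfolding sums_def using tendsto_diff[OF tendsto_const[of x], of r 0] by simp
    have geo: "(\<lambda>j. \<epsilon> * (1/2) ^ Suc j) sums \<epsilon>"
      using sums_mult[OF power_half_series, of \<epsilon>] by simp
    have le: "p (y j) \<le> \<epsilon> * (1/2) ^ Suc j" for j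
      unfolding y_def by (rule step(1)[OF r_small])
    have summ: "summable (\<lambda>j. p (y j))"
      by (rule summable_comparison_test'[OF sums_summable[OF geo]]) (use le nonneg in auto)
    have "p x \<le> (\<Sum>j. p (y j))"
      by (rule subadd[OF y_sums summ])
    also have "\<dots> \<le> \<epsilon>"
      using suminf_le[OF le summ sums_summable[OF geo]] sums_unique[OF geo] by simp
    finally show ?thesis .
  qed
  then show ?thesis
    using \<eta>_pos by blast
qed

section \<open>Truncated means and statistical convergence\<close>

definition trunc_mean :: "(nat \<Rightarrow> 'a::real_normed_vector) \<Rightarrow> nat \<Rightarrow> real" where
  "trunc_mean s n = (\<Sum>m\<in>{1..n}. min 1 (norm (s m))) / real n"

lemma trunc_mean_nonneg: "trunc_mean s n \<ge> 0"
  unfolding trunc_mean_def by (intro divide_nonneg_nonneg sum_nonneg) auto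

lemma trunc_mean_mono:
  assumes "\<And>m. norm (s m) \<le> norm (t m)"
  shows "trunc_mean s n \<le> trunc_mean t n"
  unfolding trunc_mean_def using assms
  by (intro divide_right_mono sum_mono min.mono) auto

lemma trunc_mean_le_1: "trunc_mean s n \<le> 1"
proof -
  have "(\<Sum>m\<in>{1..n}. min 1 (norm (s m))) \<le> (\<Sum>m\<in>{1..n}. 1)"
    by (rule sum_mono) simp
  then show ?thesis
    unfolding trunc_mean_def by (cases "n = 0") (simp_all add: divide_le_eq_1)
qed

lemma trunc_mean_const:
  assumes "n > 0"
  shows "trunc_mean (\<lambda>_. x) n = min 1 (norm x)"
  using assms by (simp add: trunc_mean_def)

lemma trunc_mean_add: "trunc_mean (\<lambda>m. s m + t m) n \<le> trunc_mean s n + trunc_mean t n"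
proof -
  have "min 1 (norm (s m + t m)) \<le> min 1 (norm (s m)) + min 1 (norm (t m))" for m
    using norm_triangle_ineq[of "s m" "t m"] norm_ge_zero[of "s m"] norm_ge_zero[of "t m"]
    by linarith
  then have "(\<Sum>m\<in>{1..n}. min 1 (norm (s m + t m)))
      \<le> (\<Sum>m\<in>{1..n}. min 1 (norm (s m))) + (\<Sum>m\<in>{1..n}. min 1 (norm (t m)))"
    unfolding sum.distrib[symmetric] by (intro sum_mono)
  then show ?thesis
    unfolding trunc_mean_def add_divide_distrib[symmetric] by (rule divide_right_mono) simp
qed

lemma trunc_mean_uminus: "trunc_mean (\<lambda>m. - s m) n = trunc_mean s n"
  by (simp add: trunc_mean_def)

text \<open>
  Only the finitely many terms \<open>1..n\<close> of a sequence enter \<^term>\<open>trunc_mean s n\<close>, so it is continuous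
  under termwise limits, and finite subadditivity passes to series.
\<close>

lemma trunc_mean_suminf:
  assumes sums: "\<And>m. (\<lambda>j. g j m) sums h m"
    and summ: "summable (\<lambda>j. trunc_mean (g j) n)"
  shows "trunc_mean h n \<le> (\<Sum>j. trunc_mean (g j) n)"
proof (rule LIMSEQ_le_const2)
  show "(\<lambda>J. trunc_mean (\<lambda>m. \<Sum>j<J. g j m) n) \<longlonglongrightarrow> trunc_mean h n"
    unfolding trunc_mean_def divide_inverse using sums unfolding sums_def
    by (intro tendsto_intros) auto
  have "trunc_mean (\<lambda>m. \<Sum>j<J. g j m) n \<le> (\<Sum>j<J. trunc_mean (g j) n)" for J
  proof (induction J)
    case 0
    show ?case by (simp add: trunc_mean_def)
  next
    case (Suc J)
    then show ?case
      using trunc_mean_add[of "\<lambda>m. \<Sum>j<J. g j m" "g J" n] by simp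
  qed
  then have "trunc_mean (\<lambda>m. \<Sum>j<J. g j m) n \<le> (\<Sum>j. trunc_mean (g j) n)" for J
    by (rule order_trans) (intro sum_le_suminf summ ballI trunc_mean_nonneg, simp)
  then show "\<exists>N. \<forall>J\<ge>N. trunc_mean (\<lambda>m. \<Sum>j<J. g j m) n \<le> (\<Sum>j. trunc_mean (g j) n)"
    by blast
qed

lemma sum_of_bool_notin:
  "(\<Sum>m\<in>{1..n}. of_bool (m \<notin> A)) = real n - real (card (A \<inter> {1..n}))"
proof -
  have "real n = real (card ({1..n} \<inter> {m. m \<notin> A})) + real (card (A \<inter> {1..n}))"
    using card_Diff_subset_Int[of "{1..n}" A] card_mono[of "{1..n}" "A \<inter> {1..n}"]
    by (auto simp: Int_commute Diff_eq Compl_eq)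
  then show ?thesis
    by (simp add: sum_of_bool_eq)
qed

text \<open>
  Truncation at 1 makes the exceptional set, where \<open>s m\<close> is far from \<open>l\<close>, contribute at most its
  relative frequency to the average; conversely each exceptional index contributes a fixed
  positive amount, as in Markov's inequality.
\<close>

lemma tendsto_statistical_iff:
  "(s \<longlongrightarrow> l) statistical \<longleftrightarrow> trunc_mean (\<lambda>m. s m - l) \<longlonglongrightarrow> 0"
proof
  assume lim: "(s \<longlongrightarrow> l) statistical"
  show "trunc_mean (\<lambda>m. s m - l) \<longlonglongrightarrow> 0"
  proof (rule order_tendstoI)
    fix a :: real
    assume "a < 0"
    then show "\<forall>\<^sub>F n in sequentially. a < trunc_mean (\<lambda>m. s m - l) n"
      by (intro always_eventually allI) (rule less_le_trans[OF _ trunc_mean_nonneg])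
  next
    fix a :: real
    assume "0 < a"
    define A where "A = {m. dist (s m) l < a / 2}"
    have "has_density_one A"
      using tendstoD[OF lim, of "a / 2"] \<open>0 < a\<close> by (simp add: eventually_statistical A_def)
    then have "\<forall>\<^sub>F n in sequentially. 1 - a / 2 < real (card (A \<inter> {1..n})) / real n"
      unfolding has_density_one_def by (rule order_tendstoD) (use \<open>0 < a\<close> in simp)
    then show "\<forall>\<^sub>F n in sequentially. trunc_mean (\<lambda>m. s m - l) n < a"
      using eventually_gt_at_top[of 0]
    proof eventually_elim
      case (elim n)
      have "(\<Sum>m\<in>{1..n}. min 1 (norm (s m - l))) \<le> (\<Sum>m\<in>{1..n}. a / 2 + of_bool (m \<notin> A))"
        using \<open>0 < a\<close> by (intro sum_mono) (auto simp: A_def dist_norm min_def)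
      also have "\<dots> = real n * (a / 2) + (real n - real (card (A \<inter> {1..n})))"
        by (simp only: sum.distrib sum_of_bool_notin) simp
      finally have "trunc_mean (\<lambda>m. s m - l) n
          \<le> (real n * (a / 2) + (real n - real (card (A \<inter> {1..n})))) / real n"
        unfolding trunc_mean_def by (rule divide_right_mono) simp
      also have "\<dots> = a / 2 + (1 - real (card (A \<inter> {1..n})) / real n)"
        using elim(2) by (simp add: field_simps)
      finally show ?case
        using elim(1) by linarith
    qed
  qed
next
  assume lim: "trunc_mean (\<lambda>m. s m - l) \<longlonglongrightarrow> 0"
  show "(s \<longlongrightarrow> l) statistical"
  proof (rule tendstoI)
    fix \<epsilon> :: real
    assume "0 < \<epsilon>"
    define c where "c = min 1 \<epsilon>"
    define A where "A = {m. dist (s m) l < \<epsilon>}"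
    have "c > 0"
      using \<open>0 < \<epsilon>\<close> by (simp add: c_def)
    have le: "1 - trunc_mean (\<lambda>m. s m - l) n / c \<le> real (card (A \<inter> {1..n})) / real n"
      if "n > 0" for n
    proof -
      have "c * (real n - real (card (A \<inter> {1..n}))) = (\<Sum>m\<in>{1..n}. c * of_bool (m \<notin> A))"
        by (simp only: sum_distrib_left[symmetric] sum_of_bool_notin)
      also have "\<dots> \<le> (\<Sum>m\<in>{1..n}. min 1 (norm (s m - l)))"
        using \<open>0 < \<epsilon>\<close> by (intro sum_mono) (auto simp: A_def c_def dist_norm min_def)
      also have "\<dots> = real n * trunc_mean (\<lambda>m. s m - l) n"
        using that by (simp add: trunc_mean_def)
      finally show ?thesis
        using that \<open>c > 0\<close> by (simp add: field_simps)
    qed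
    have "has_density_one A"
      unfolding has_density_one_def
    proof (rule tendsto_sandwich[OF _ _ _ tendsto_const])
      show "\<forall>\<^sub>F n in sequentially. 1 - trunc_mean (\<lambda>m. s m - l) n / c
          \<le> real (card (A \<inter> {1..n})) / real n"
        using le by (intro eventually_mono[OF eventually_gt_at_top[of 0]])
      show "(\<lambda>n. 1 - trunc_mean (\<lambda>m. s m - l) n / c) \<longlonglongrightarrow> 1"
        using tendsto_diff[OF tendsto_const[of 1] tendsto_divide[OF lim tendsto_const[of c]]]
          \<open>c > 0\<close> by simp
      have "card (A \<inter> {1..n}) \<le> n" for n
        using card_mono[of "{1..n}" "A \<inter> {1..n}"] by auto
      then show "\<forall>\<^sub>F n in sequentially. real (card (A \<inter> {1..n})) / real n \<le> 1"
        by (intro eventually_mono[OF eventually_gt_at_top[of 0]]) (simp add: divide_le_eq_1)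
    qed
    then show "\<forall>\<^sub>F m in statistical. dist (s m) l < \<epsilon>"
      by (simp add: eventually_statistical A_def)
  qed
qed

text \<open>
  Up to the term of index 0, which partial sums have equal to 0, this is an F-norm on the
  statistically convergent sequences: the supremum of the truncated
  means replaces the supremum norm, which may be infinite there.
\<close>

definition trunc_norm :: "(nat \<Rightarrow> 'a::real_normed_vector) \<Rightarrow> real" where
  "trunc_norm s = (SUP n. trunc_mean s n)"

lemma trunc_mean_le_trunc_norm: "trunc_mean s n \<le> trunc_norm s"
  unfolding trunc_norm_def
  by (rule cSUP_upper) (auto intro!: bdd_aboveI[of _ 1] trunc_mean_le_1)

lemma trunc_norm_least: "(\<And>n. trunc_mean s n \<le> c) \<Longrightarrow> trunc_norm s \<le> c"
  unfolding trunc_norm_def by (rule cSUP_least) auto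

lemma trunc_norm_nonneg: "trunc_norm s \<ge> 0"
  using trunc_mean_nonneg trunc_mean_le_trunc_norm by (rule order_trans)

lemma trunc_norm_bounds_terms:
  assumes "m > 0"
  shows "min 1 (norm (s m)) \<le> real m * trunc_norm s"
proof -
  have "min 1 (norm (s m)) \<le> (\<Sum>i\<in>{1..m}. min 1 (norm (s i)))"
    using assms by (intro member_le_sum) auto
  also have "\<dots> = real m * trunc_mean s m"
    using assms by (simp add: trunc_mean_def)
  also have "\<dots> \<le> real m * trunc_norm s"
    by (intro mult_left_mono trunc_mean_le_trunc_norm) simp
  finally show ?thesis .
qed

lemma trunc_norm_bounds_limit:
  assumes "(s \<longlongrightarrow> l) statistical"
  shows "min 1 (norm l) \<le> trunc_norm s"
proof (rule tendsto_lowerbound)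
  show "(\<lambda>n. trunc_mean (\<lambda>m. s m - l) n + trunc_norm s) \<longlonglongrightarrow> trunc_norm s"
    using tendsto_add[OF assms[unfolded tendsto_statistical_iff] tendsto_const] by simp
  have "min 1 (norm l) \<le> trunc_mean (\<lambda>m. s m - l) n + trunc_norm s" if "n > 0" for n
    using trunc_mean_add[of "\<lambda>m. - (s m - l)" s n] trunc_mean_le_trunc_norm[of s n]
      trunc_mean_const[OF that, of l] trunc_mean_uminus[of "\<lambda>m. s m - l" n] by simp
  then show "\<forall>\<^sub>F n in sequentially.
      min 1 (norm l) \<le> trunc_mean (\<lambda>m. s m - l) n + trunc_norm s"
    by (intro eventually_mono[OF eventually_gt_at_top[of 0]])
qed simp

text \<open>
  The truncated norm is not homogeneous, and on arbitrary sequences it need not shrink under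
  scaling: it is 1 for all nonzero multiples of a sequence whose norms tend to infinity. Statistical
  convergence excludes this. For large \<open>n\<close> the means of \<open>s m - l\<close> are small already before scaling,
  and what remains, the limit \<open>l\<close> and finitely many terms of \<open>s\<close>, is bounded.
\<close>

lemma trunc_norm_shrink:
  assumes "(s \<longlongrightarrow> l) statistical"
  shows "(\<lambda>k. trunc_norm (\<lambda>m. s m /\<^sub>R real (Suc k))) \<longlonglongrightarrow> 0"
proof (rule order_tendstoI)
  fix a :: real
  assume "a < 0"
  then show "\<forall>\<^sub>F k in sequentially. a < trunc_norm (\<lambda>m. s m /\<^sub>R real (Suc k))"
    by (intro always_eventually allI) (rule less_le_trans[OF _ trunc_norm_nonneg])
next
  fix a :: real
  assume "0 < a"
  then have "\<forall>\<^sub>F n in sequentially. trunc_mean (\<lambda>m. s m - l) n < a / 4"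
    using assms unfolding tendsto_statistical_iff by (intro order_tendstoD) auto
  then obtain N where N: "\<And>n. n \<ge> N \<Longrightarrow> trunc_mean (\<lambda>m. s m - l) n < a / 4"
    unfolding eventually_sequentially by blast
  define M where "M = norm l + (\<Sum>m\<in>{1..N}. norm (s m))"
  have M_nonneg: "norm l \<ge> 0" "(\<Sum>m\<in>{1..N}. norm (s m)) \<ge> 0"
    by (auto intro: sum_nonneg)
  have bound: "trunc_mean (\<lambda>m. s m /\<^sub>R real (Suc k)) n \<le> a / 4 + M / real (Suc k)" for k n
  proof (cases "n \<ge> N")
    case True
    have "trunc_mean (\<lambda>m. s m /\<^sub>R real (Suc k)) n
        \<le> trunc_mean (\<lambda>m. (s m - l) /\<^sub>R real (Suc k)) n + trunc_mean (\<lambda>m. l /\<^sub>R real (Suc k)) n"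
      using trunc_mean_add[of "\<lambda>m. (s m - l) /\<^sub>R real (Suc k)" "\<lambda>m. l /\<^sub>R real (Suc k)" n]
      by (simp add: scaleR_add_right[symmetric])
    also have "trunc_mean (\<lambda>m. (s m - l) /\<^sub>R real (Suc k)) n \<le> trunc_mean (\<lambda>m. s m - l) n"
      by (rule trunc_mean_mono) (simp add: mult_left_le_one_le inverse_le_1_iff)
    also have "\<dots> \<le> a / 4"
      using N[OF True] by simp
    also have "trunc_mean (\<lambda>m. l /\<^sub>R real (Suc k)) n \<le> norm l / real (Suc k)"
    proof (cases "n = 0")
      case False
      then have "trunc_mean (\<lambda>m. l /\<^sub>R real (Suc k)) n = min 1 (norm (l /\<^sub>R real (Suc k)))"
        by (intro trunc_mean_const) simp
      then show ?thesis
        by (simp add: divide_inverse mult.commute)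
    qed (simp add: trunc_mean_def)
    also have "\<dots> \<le> M / real (Suc k)"
      using M_nonneg by (intro divide_right_mono) (auto simp: M_def)
    finally show ?thesis
      by simp
  next
    case False
    have "trunc_mean (\<lambda>m. s m /\<^sub>R real (Suc k)) n \<le> (\<Sum>m\<in>{1..n}. norm (s m) / real (Suc k))"
    proof -
      have "(\<Sum>m\<in>{1..n}. min 1 (norm (s m /\<^sub>R real (Suc k)))) / real n
          \<le> (\<Sum>m\<in>{1..n}. min 1 (norm (s m /\<^sub>R real (Suc k))))"
        unfolding divide_inverse
        by (cases "n = 0") (auto intro!: mult_right_le_one_le sum_nonneg simp: inverse_le_1_iff)
      also have "\<dots> \<le> (\<Sum>m\<in>{1..n}. norm (s m) / real (Suc k))"
        by (intro sum_mono) (simp add: divide_inverse mult.commute)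
      finally show ?thesis
        by (simp add: trunc_mean_def)
    qed
    also have "\<dots> \<le> (\<Sum>m\<in>{1..N}. norm (s m) / real (Suc k))"
      using False by (intro sum_mono2) auto
    also have "\<dots> \<le> M / real (Suc k)"
      unfolding sum_divide_distrib[symmetric] using M_nonneg
      by (intro divide_right_mono) (auto simp: M_def)
    finally show ?thesis
      using \<open>0 < a\<close> by simp
  qed
  have "(\<lambda>k. M * inverse (real (Suc k))) \<longlonglongrightarrow> M * 0"
    by (intro tendsto_mult tendsto_const LIMSEQ_inverse_real_of_nat)
  then have "\<forall>\<^sub>F k in sequentially. M * inverse (real (Suc k)) < a / 4"
    by (rule order_tendstoD(2)) (use \<open>0 < a\<close> in simp)
  then show "\<forall>\<^sub>F k in sequentially. trunc_norm (\<lambda>m. s m /\<^sub>R real (Suc k)) < a"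
  proof eventually_elim
    case (elim k)
    have "trunc_norm (\<lambda>m. s m /\<^sub>R real (Suc k)) \<le> a / 4 + M * inverse (real (Suc k))"
      using trunc_norm_least[OF bound] by (simp only: divide_inverse)
    then show ?case
      using elim \<open>0 < a\<close> by linarith
  qed
qed

lemma trunc_norm_suminf:
  assumes sums: "\<And>m. (\<lambda>j. g j m) sums h m"
    and summ: "summable (\<lambda>j. trunc_norm (g j))"
  shows "trunc_norm h \<le> (\<Sum>j. trunc_norm (g j))"
proof (rule trunc_norm_least)
  fix n
  have summ': "summable (\<lambda>j. trunc_mean (g j) n)"
    by (rule summable_comparison_test'[OF summ])
      (auto simp: trunc_mean_nonneg trunc_mean_le_trunc_norm)
  have "trunc_mean h n \<le> (\<Sum>j. trunc_mean (g j) n)"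
    by (rule trunc_mean_suminf[OF sums summ'])
  also have "\<dots> \<le> (\<Sum>j. trunc_norm (g j))"
    by (intro suminf_le trunc_mean_le_trunc_norm summ summ')
  finally show "trunc_mean h n \<le> (\<Sum>j. trunc_norm (g j))" .
qed

text \<open>
  Completeness of the space of statistically convergent sequences, in terms of series. By countable
  subadditivity the truncated means of \<open>h m - L\<close> are bounded by the sum over \<open>j\<close> of those of
  \<open>g j m - l j\<close>. Each summand tends to 0 and is dominated by \<^term>\<open>2 * trunc_norm (g j)\<close>, because the
  truncated norm also dominates the limit \<open>l j\<close>; so Tannery's theorem applies.
\<close>

lemma statistical_limit_suminf:
  assumes lims: "\<And>j. (g j \<longlongrightarrow> l j) statistical"
    and summ: "summable (\<lambda>j. trunc_norm (g j))"
    and sums: "\<And>m. (\<lambda>j. g j m) sums h m"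
    and l_sums: "l sums L"
  shows "(h \<longlongrightarrow> L) statistical"
  unfolding tendsto_statistical_iff
proof -
  define a where "a j = trunc_mean (\<lambda>m. g j m - l j)" for j
  have a_bound: "a j n \<le> 2 * trunc_norm (g j)" for j n
  proof (cases "n = 0")
    case True
    then show ?thesis
      using trunc_norm_nonneg[of "g j"] by (simp add: a_def trunc_mean_def)
  next
    case False
    then show ?thesis
      using trunc_mean_add[of "g j" "\<lambda>m. - l j" n] trunc_mean_le_trunc_norm[of "g j" n]
        trunc_mean_const[of n "- l j"] trunc_norm_bounds_limit[OF lims, of j]
      by (simp add: a_def)
  qed
  have a_nonneg: "a j n \<ge> 0" for j n
    unfolding a_def by (rule trunc_mean_nonneg)
  have summ2: "summable (\<lambda>j. 2 * trunc_norm (g j))"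
    using summ by (rule summable_mult)
  have summ_a: "summable (\<lambda>j. a j n)" for n
    by (rule summable_comparison_test'[OF summ2]) (simp add: a_nonneg a_bound)
  have "(\<lambda>n. \<Sum>j. a j n) \<longlonglongrightarrow> (\<Sum>j. 0)"
  proof (rule tannerys_theorem[THEN conjunct2, THEN conjunct2])
    show "(\<lambda>n. a j n) \<longlonglongrightarrow> 0" for j
      using lims[of j] by (simp add: a_def tendsto_statistical_iff)
    show "\<forall>\<^sub>F (j, n) in sequentially \<times>\<^sub>F sequentially. norm (a j n) \<le> 2 * trunc_norm (g j)"
      by (intro always_eventually) (simp add: a_nonneg a_bound split_beta)
    show "summable (\<lambda>j. 2 * trunc_norm (g j))"
      by (rule summ2)
  qed simp
  then have lim: "(\<lambda>n. \<Sum>j. a j n) \<longlonglongrightarrow> 0"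
    by simp
  have le: "trunc_mean (\<lambda>m. h m - L) n \<le> (\<Sum>j. a j n)" for n
    unfolding a_def
    by (rule trunc_mean_suminf) (use summ_a in \<open>auto simp: a_def intro: sums_diff sums l_sums\<close>)
  show "trunc_mean (\<lambda>m. h m - L) \<longlonglongrightarrow> 0"
    by (rule tendsto_sandwich[OF _ _ tendsto_const lim])
      (auto intro!: always_eventually simp: trunc_mean_nonneg le)
qed

section \<open>Statistical bases\<close>

locale statistical_basis = normed_space_over smul
  for smul :: "'k::{real_normed_field,banach} \<Rightarrow> 'a::banach \<Rightarrow> 'a" +
  fixes e :: "nat \<Rightarrow> 'a"
  assumes basis: "filter_basis statistical smul e"
begin

definition coord :: "nat \<Rightarrow> 'a \<Rightarrow> 'k" where
  "coord = coordinate statistical smul e"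

definition partial_sum :: "'a \<Rightarrow> nat \<Rightarrow> 'a" where
  "partial_sum x m = (\<Sum>i<m. smul (coord i x) (e i))"

lemma partial_sum_tendsto: "(partial_sum x \<longlongrightarrow> x) statistical"
proof -
  have "\<exists>!c. filter_sums statistical (\<lambda>i. smul (c i) (e i)) x"
    using basis unfolding filter_basis_def by (rule spec)
  from theI'[OF this] have "filter_sums statistical
      (\<lambda>i. smul ((THE c. filter_sums statistical (\<lambda>i. smul (c i) (e i)) x) i) (e i)) x" .
  then show ?thesis
    unfolding filter_sums_def partial_sum_def coord_def coordinate_def .
qed

lemma coord_unique:
  assumes "((\<lambda>m. \<Sum>i<m. smul (c i) (e i)) \<longlongrightarrow> x) statistical"
  shows "coord i x = c i"
proof -
  have "(THE c. filter_sums statistical (\<lambda>i. smul (c i) (e i)) x) = c"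
    using basis assms unfolding filter_basis_def filter_sums_def
    by (intro the1_equality) auto
  then show ?thesis
    unfolding coord_def coordinate_def by simp
qed

lemma coord_add: "coord i (x + y) = coord i x + coord i y"
  using tendsto_add[OF partial_sum_tendsto[of x] partial_sum_tendsto[of y]]
  by (intro coord_unique) (simp add: partial_sum_def scale_left_distrib sum.distrib)

lemma coord_scaleR: "coord i (r *\<^sub>R x) = of_real r * coord i x"
  using tendsto_scaleR[OF tendsto_const[of r] partial_sum_tendsto[of x]]
  by (intro coord_unique)
    (simp add: partial_sum_def smul_of_real[symmetric] scale_sum_right)

lemma coord_diff: "coord i (x - y) = coord i x - coord i y"
  using coord_add[of i "x - y" y] by simp

lemma partial_sum_scaleR: "partial_sum (r *\<^sub>R x) m = r *\<^sub>R partial_sum x m"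
  unfolding partial_sum_def coord_scaleR
  by (simp add: smul_of_real[symmetric] scale_sum_right)

text \<open>The coefficient of a zero vector could be changed at will, against uniqueness.\<close>

lemma e_nonzero: "e i \<noteq> 0"
proof
  assume "e i = 0"
  define c where "c = (\<lambda>j. coord j 0)(i := coord i 0 + 1)"
  have "smul (c j) (e j) = smul (coord j 0) (e j)" for j
    using \<open>e i = 0\<close> by (cases "j = i") (simp_all add: c_def)
  then have "(\<lambda>m. \<Sum>j<m. smul (c j) (e j)) = partial_sum 0"
    by (simp only: partial_sum_def[abs_def])
  then have "coord i 0 = c i"
    using partial_sum_tendsto[of 0] by (intro coord_unique) simp
  then show False
    by (simp add: c_def)
qed

lemma norm_coord_le:
  "norm (coord i x) * norm (e i) \<le> norm (partial_sum x (Suc i)) + norm (partial_sum x i)"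
proof -
  have "smul (coord i x) (e i) = partial_sum x (Suc i) - partial_sum x i"
    by (simp add: partial_sum_def)
  then show ?thesis
    using norm_triangle_ineq4[of "partial_sum x (Suc i)" "partial_sum x i"] by (simp flip: norm_smul)
qed

definition series_gauge :: "'a \<Rightarrow> real" where
  "series_gauge x = trunc_norm (partial_sum x)"

lemma norm_partial_sum_le:
  assumes "real m * series_gauge x < 1"
  shows "norm (partial_sum x m) \<le> real m * series_gauge x"
proof (cases "m = 0")
  case True
  then show ?thesis
    by (simp add: partial_sum_def)
next
  case False
  then show ?thesis
    using trunc_norm_bounds_terms[of m "partial_sum x"] assms
    by (auto simp: series_gauge_def min_def split: if_splits)
qed

lemma summable_norm_partial_sum:
  assumes "summable (\<lambda>j. series_gauge (f j))"
  shows "summable (\<lambda>j. norm (partial_sum (f j) m))"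
proof (rule summable_comparison_test_ev)
  show "summable (\<lambda>j. real m * series_gauge (f j))"
    using assms by (rule summable_mult)
  then have "\<forall>\<^sub>F j in sequentially. real m * series_gauge (f j) < 1"
    by (intro order_tendstoD(2)[OF summable_LIMSEQ_zero]) auto
  then show "\<forall>\<^sub>F j in sequentially. norm (norm (partial_sum (f j) m)) \<le> real m * series_gauge (f j)"
    by eventually_elim (simp add: norm_partial_sum_le)
qed

text \<open>
  The gauge bounds the partial sums only up to a factor depending on the index, and only where it
  is small; this is enough for the coefficients at each fixed index to be summable.
\<close>

lemma summable_coord:
  assumes "summable (\<lambda>j. series_gauge (f j))"
  shows "summable (\<lambda>j. coord i (f j))"
proof (rule summable_comparison_test')
  show "summable (\<lambda>j. (norm (partial_sum (f j) (Suc i)) + norm (partial_sum (f j) i)) / norm (e i))"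
    by (intro summable_divide summable_add summable_norm_partial_sum assms)
  show "norm (coord i (f j))
      \<le> (norm (partial_sum (f j) (Suc i)) + norm (partial_sum (f j) i)) / norm (e i)"
    if "j \<ge> 0" for j
    using norm_coord_le e_nonzero by (simp add: pos_le_divide_eq)
qed

lemma smul_sums:
  assumes "c sums d"
  shows "(\<lambda>j. smul (c j) v) sums smul d v"
proof -
  have "(\<lambda>J. (\<Sum>j<J. c j) - d) \<longlonglongrightarrow> 0"
    using assms unfolding sums_def by (rule LIM_zero)
  then have "(\<lambda>J. norm ((\<Sum>j<J. c j) - d) * norm v) \<longlonglongrightarrow> 0"
    by (intro tendsto_mult_left_zero tendsto_norm_zero)
  moreover have "norm ((\<Sum>j<J. c j) - d) * norm v = norm ((\<Sum>j<J. smul (c j) v) - smul d v)" for J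
    by (simp add: norm_smul[symmetric] scale_left_diff_distrib scale_sum_left)
  ultimately have "(\<lambda>J. (\<Sum>j<J. smul (c j) v) - smul d v) \<longlonglongrightarrow> 0"
    by (simp add: tendsto_norm_zero_iff)
  then show ?thesis
    unfolding sums_def by (rule LIM_zero_cancel)
qed

text \<open>
  Summing the coefficients of the \<open>f j\<close> termwise gives a coefficient sequence whose series
  converges statistically to \<open>x\<close>, by completeness. By uniqueness it is the expansion of \<open>x\<close>, so
  that the partial sums of \<open>x\<close> are the sums of those of the \<open>f j\<close>.
\<close>

lemma series_gauge_countably_subadditive:
  assumes f: "f sums x" and summ: "summable (\<lambda>j. series_gauge (f j))"
  shows "series_gauge x \<le> (\<Sum>j. series_gauge (f j))"
proof -
  define c where "c i = (\<Sum>j. coord i (f j))" for i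
  have "(\<lambda>j. coord i (f j)) sums c i" for i
    unfolding c_def by (intro summable_sums summable_coord summ)
  then have sums: "(\<lambda>j. partial_sum (f j) m) sums (\<Sum>i<m. smul (c i) (e i))" for m
    unfolding partial_sum_def by (intro sums_sum smul_sums)
  have "((\<lambda>m. \<Sum>i<m. smul (c i) (e i)) \<longlongrightarrow> x) statistical"
    by (rule statistical_limit_suminf[OF partial_sum_tendsto summ[unfolded series_gauge_def] sums f])
  then have "coord i x = c i" for i
    by (rule coord_unique)
  then have "(\<lambda>j. partial_sum (f j) m) sums partial_sum x m" for m
    using sums[of m] by (simp add: partial_sum_def)
  then show ?thesis
    using summ unfolding series_gauge_def by (rule trunc_norm_suminf)
qed

lemma series_gauge_small:
  assumes "\<epsilon> > 0"
  shows "\<exists>\<delta>>0. \<forall>x. norm x < \<delta> \<longrightarrow> series_gauge x \<le> \<epsilon>"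
proof (rule countably_subadditive_gauge_continuous_at_0)
  show "series_gauge x \<ge> 0" for x
    unfolding series_gauge_def by (rule trunc_norm_nonneg)
  show "series_gauge (- x) = series_gauge x" for x
  proof -
    have "partial_sum (- x) = (\<lambda>m. - partial_sum x m)"
      using partial_sum_scaleR[of "- 1" x] by auto
    then show ?thesis
      by (simp add: series_gauge_def trunc_norm_def trunc_mean_uminus)
  qed
  show "(\<lambda>k. series_gauge (x /\<^sub>R real (Suc k))) \<longlonglongrightarrow> 0" for x
    unfolding series_gauge_def partial_sum_scaleR
    by (rule trunc_norm_shrink[OF partial_sum_tendsto])
qed (fact series_gauge_countably_subadditive assms)+

lemma coord_small:
  assumes "\<epsilon> > 0"
  shows "\<exists>\<delta>>0. \<forall>x. norm x < \<delta> \<longrightarrow> norm (coord i x) < \<epsilon>"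
proof -
  \<comment> \<open>Below 1 the truncation has no effect; the second bound survives adding two partial sums and
    dividing by the norm of the basis vector.\<close>
  define a where "a = min (1/2) (\<epsilon> * norm (e i) / 4)"
  have "norm (e i) > 0"
    using e_nonzero by simp
  then have "a > 0"
    using assms by (simp add: a_def)
  then obtain \<delta> where "\<delta> > 0" and \<delta>: "\<And>x. norm x < \<delta> \<Longrightarrow> series_gauge x \<le> a / real (Suc i)"
    using series_gauge_small[of "a / real (Suc i)"] by (auto simp del: of_nat_Suc)
  have "norm (coord i x) < \<epsilon>" if "norm x < \<delta>" for x
  proof -
    have small: "norm (partial_sum x m) \<le> a" if "m \<le> Suc i" for m
    proof -
      have "real m * series_gauge x \<le> real (Suc i) * (a / real (Suc i))"
        using \<delta>[OF \<open>norm x < \<delta>\<close>] that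
        by (intro mult_mono) (auto simp: series_gauge_def trunc_norm_nonneg)
      then have le: "real m * series_gauge x \<le> a"
        by (simp del: of_nat_Suc)
      have "norm (partial_sum x m) \<le> real m * series_gauge x"
        by (rule norm_partial_sum_le) (use le in \<open>auto simp: a_def\<close>)
      then show ?thesis
        using le by (rule order_trans)
    qed
    have "norm (coord i x) * norm (e i) \<le> a + a"
      using norm_coord_le[of i x] small[of "Suc i"] small[of i] by simp
    also have "\<dots> < \<epsilon> * norm (e i)"
      using \<open>norm (e i) > 0\<close> assms by (simp add: a_def min_def field_simps)
    finally show ?thesis
      using \<open>norm (e i) > 0\<close> by simp
  qed
  then show ?thesis
    using \<open>\<delta> > 0\<close> by blast
qed

theorem continuous_coordinate: "continuous_on UNIV (coordinate statistical smul e i)"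
proof -
  have "continuous_on UNIV (coord i)"
    unfolding continuous_on_iff
  proof (intro ballI allI impI)
    fix x :: 'a and \<epsilon> :: real
    assume "\<epsilon> > 0"
    then obtain \<delta> where "\<delta> > 0" and \<delta>: "\<And>z. norm z < \<delta> \<Longrightarrow> norm (coord i z) < \<epsilon>"
      using coord_small by blast
    have "dist (coord i y) (coord i x) < \<epsilon>" if "dist y x < \<delta>" for y
      using \<delta>[of "y - x"] that by (simp add: dist_norm coord_diff)
    then show "\<exists>\<delta>>0. \<forall>y\<in>UNIV. dist y x < \<delta> \<longrightarrow> dist (coord i y) (coord i x) < \<epsilon>"
      using \<open>\<delta> > 0\<close> by blast
  qed
  then show ?thesis
    by (simp add: coord_def)
qed

end

theorem corollary1:
  "(\<forall>(smul :: real \<Rightarrow> 'a::banach \<Rightarrow> 'a) e.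
      normed_space_over smul \<longrightarrow> filter_basis statistical smul e \<longrightarrow>
      (\<forall>n. continuous_on UNIV (coordinate statistical smul e n))) \<and>
   (\<forall>(smul :: complex \<Rightarrow> 'a::banach \<Rightarrow> 'a) e.
      normed_space_over smul \<longrightarrow> filter_basis statistical smul e \<longrightarrow>
      (\<forall>n. continuous_on UNIV (coordinate statistical smul e n)))"
  by (intro conjI allI impI statistical_basis.continuous_coordinate statistical_basis.intro
      statistical_basis_axioms.intro)

end
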